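(* Let $d_S$ be a Cayley metric on a (finitely generated) group $G$. If the set of Busemann points $\partial_b(G,d_S)$ is finite, then the annihilator $N=N_{\partial(G,d_S)}$ is finite.
   Context: Cayley metric: for a finite symmetric generating set $S$ of $G$, the Cayley graph $\Gamma(G,S)$ has vertex set $G$ and edges $\{x,xs\}$ for $x\in G$, $s\in S$; $d_S$ is its graph metric. A Cayley metric is any metric of the form $d_S$ with $S$ a finite symmetric generating set. Metric-functional boundary: for $x\in G$ let $b_x\colon G\to\mathbb{R}$, $b_x(y)=d_S(x,y)-d_S(x,1)$. Let $\overline{(G,d_S)}$ be the closure of $\{b_x : x\in G\}$ in the space of functions $G\to\mathbb{R}$ with the topology of pointwise convergence. Then $\partial(G,d_S)=\overline{(G,d_S)}\setminus\{b_x : x\in G\}$. Busemann points: an infinite geodesic is a sequence $\gamma=(\gamma_n)_{n\ge 0}$ in $G$ with $d_S(\gamma_i,\gamma_j)=|i-j|$ for all $i,j\ge 0$. For such $\gamma$ the pointwise limit $\gamma_\infty=\lim_n b_{\gamma_n}$ exists and lies in $\partial(G,d_S)$. $\partial_b(G,d_S)$ is the set of all such $\gamma_\infty$, over all infinite geodesics $\gamma$ (with arbitrary starting point). Annihilator: for $L\subseteq\partial(G,d_S)$, $N_L=\{x\in G : h(x)=0 \text{ for all } h\in L\}$. *)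

theory Defs
  imports "HOL-Analysis.Analysis" "HOL-Algebra.Generated_Groups"
begin

definition symmetric_generating_set :: "('a, 'b) monoid_scheme \<Rightarrow> 'a set \<Rightarrow> bool" where
  "symmetric_generating_set G S \<longleftrightarrow>
     S \<subseteq> carrier G \<and> (\<forall>s\<in>S. inv\<^bsub>G\<^esub> s \<in> S) \<and> generate G S = carrier G"

(* Edges as ordered pairs; for S closed under inverses this relation is symmetric, so it is
   the adjacency relation of the undirected Cayley graph with edges {x, x s}.  If the identity
   lies in S there are loops, which do not affect distances. *)
definition cayley_edges :: "('a, 'b) monoid_scheme \<Rightarrow> 'a set \<Rightarrow> ('a \<times> 'a) set" where
  "cayley_edges G S = {(x, x \<otimes>\<^bsub>G\<^esub> s) | x s. x \<in> carrier G \<and> s \<in> S}"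

(* Graph metric: the least length of a path from x to y.  Only meaningful for x, y in the
   carrier and S generating, when such a path exists. *)
definition cayley_dist :: "('a, 'b) monoid_scheme \<Rightarrow> 'a set \<Rightarrow> 'a \<Rightarrow> 'a \<Rightarrow> real" where
  "cayley_dist G S x y = real (LEAST n. (x, y) \<in> cayley_edges G S ^^ n)"

definition cayley_metric :: "('a, 'b) monoid_scheme \<Rightarrow> ('a \<Rightarrow> 'a \<Rightarrow> real) \<Rightarrow> bool" where
  "cayley_metric G d \<longleftrightarrow>
     (\<exists>S. finite S \<and> symmetric_generating_set G S \<and> d = cayley_dist G S)"

(* Real functions on the group are the extensional functions on the carrier, i.e. the points
   of powertop_real (carrier G), whose topology is that of pointwise convergence. *)
definition metric_functional ::
    "('a, 'b) monoid_scheme \<Rightarrow> ('a \<Rightarrow> 'a \<Rightarrow> real) \<Rightarrow> 'a \<Rightarrow> 'a \<Rightarrow> real" where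
  "metric_functional G d x = (\<lambda>y\<in>carrier G. d x y - d x \<one>\<^bsub>G\<^esub>)"

definition metric_compactification ::
    "('a, 'b) monoid_scheme \<Rightarrow> ('a \<Rightarrow> 'a \<Rightarrow> real) \<Rightarrow> ('a \<Rightarrow> real) set" where
  "metric_compactification G d =
     Abstract_Topology.closure_of (powertop_real (carrier G)) (metric_functional G d ` carrier G)"

definition metric_boundary ::
    "('a, 'b) monoid_scheme \<Rightarrow> ('a \<Rightarrow> 'a \<Rightarrow> real) \<Rightarrow> ('a \<Rightarrow> real) set" where
  "metric_boundary G d = metric_compactification G d - metric_functional G d ` carrier G"

definition infinite_geodesic ::
    "('a, 'b) monoid_scheme \<Rightarrow> ('a \<Rightarrow> 'a \<Rightarrow> real) \<Rightarrow> (nat \<Rightarrow> 'a) \<Rightarrow> bool" where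
  "infinite_geodesic G d \<gamma> \<longleftrightarrow>
     range \<gamma> \<subseteq> carrier G \<and> (\<forall>i j. d (\<gamma> i) (\<gamma> j) = \<bar>real i - real j\<bar>)"

definition busemann_points ::
    "('a, 'b) monoid_scheme \<Rightarrow> ('a \<Rightarrow> 'a \<Rightarrow> real) \<Rightarrow> ('a \<Rightarrow> real) set" where
  "busemann_points G d =
     {h. \<exists>\<gamma>. infinite_geodesic G d \<gamma> \<and>
             limitin (powertop_real (carrier G)) (\<lambda>n. metric_functional G d (\<gamma> n)) h sequentially}"

definition annihilator :: "('a, 'b) monoid_scheme \<Rightarrow> ('a \<Rightarrow> real) set \<Rightarrow> 'a set" where
  "annihilator G L = {x \<in> carrier G. \<forall>h\<in>L. h x = 0}"

end

(* G acts on the finite set B of Busemann points, and on the stabilizer H of all of them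
   every Busemann point is additive; H has finite index.  If a Busemann point f decreases at unit
   speed along a long enough window of a geodesic, two points of the window differ by some t in H,
   and translating by t^n prolongs the piece between them to an infinite geodesic.  Its Busemann
   point h dominates, up to a constant, every Busemann point decreasing along the same window;
   additivity then makes all of them equal to h on H.
   By compactness, each window of a long geodesic, away from its far end, has some Busemann point
   decreasing along it; consecutive windows overlap, so these all agree on H.  Hence a single
   Busemann point decreases linearly along the whole geodesic, up to bounded errors.  An element
   annihilated by all Busemann points therefore has bounded length. *)

theory Submission
  imports Defs
begin

section \<open>Left-invariant geodesic metrics with finite balls\<close>

locale geodesic_group = group G for G (structure) +
  fixes d :: "'a \<Rightarrow> 'a \<Rightarrow> real"
  assumes dist_refl: "x \<in> carrier G \<Longrightarrow> d x x = 0"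
    and dist_sym: "x \<in> carrier G \<Longrightarrow> y \<in> carrier G \<Longrightarrow> d x y = d y x"
    and dist_tri: "x \<in> carrier G \<Longrightarrow> y \<in> carrier G \<Longrightarrow> z \<in> carrier G \<Longrightarrow> d x z \<le> d x y + d y z"
    and dist_left: "g \<in> carrier G \<Longrightarrow> x \<in> carrier G \<Longrightarrow> y \<in> carrier G \<Longrightarrow> d (g \<otimes> x) (g \<otimes> y) = d x y"
    and finite_ball: "finite {x \<in> carrier G. d \<one> x \<le> r}"
    and path_exists: "x \<in> carrier G \<Longrightarrow> y \<in> carrier G \<Longrightarrow>
      \<exists>n p. range p \<subseteq> carrier G \<and> p 0 = x \<and> p n = y \<and> d x y = real n \<and> (\<forall>i<n. d (p i) (p (Suc i)) \<le> 1)"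
begin

lemma dist_nonneg: "x \<in> carrier G \<Longrightarrow> y \<in> carrier G \<Longrightarrow> 0 \<le> d x y"
  using dist_tri[of x y x] dist_sym[of x y] dist_refl[of x] by auto

lemma path_dist_le:
  assumes "range p \<subseteq> carrier G" "\<And>i. i < n \<Longrightarrow> d (p i) (p (Suc i)) \<le> 1" "i \<le> j" "j \<le> n"
  shows "d (p i) (p j) \<le> real j - real i"
  using assms(3,4)
proof (induction j rule: dec_induct)
  case base
  have "p i \<in> carrier G" using assms(1) by auto
  then show ?case by (simp add: dist_refl)
next
  case (step m)
  have "d (p i) (p (Suc m)) \<le> d (p i) (p m) + d (p m) (p (Suc m))"
    using assms(1) by (intro dist_tri) auto
  then show ?case using step assms(2)[of m] by auto
qed

text \<open>A path realising \<open>d x y = real n\<close> in \<open>n\<close> steps of length at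
  most 1 has no slack: each segment is at most as long as its number of steps, and the triangle
  inequality through \<open>p i\<close> and \<open>p j\<close> forces equality.\<close>

lemma geodesic_exists:
  assumes "x \<in> carrier G" "y \<in> carrier G"
  obtains n p where "range p \<subseteq> carrier G" "p 0 = x" "p n = y" "d x y = real n"
    "\<And>i j. i \<le> n \<Longrightarrow> j \<le> n \<Longrightarrow> d (p i) (p j) = \<bar>real i - real j\<bar>"
proof -
  obtain n p where p: "range p \<subseteq> carrier G" "p 0 = x" "p n = y" "d x y = real n"
    and step: "\<And>i. i < n \<Longrightarrow> d (p i) (p (Suc i)) \<le> 1"
    using path_exists[OF assms] by blast
  have pc: "p i \<in> carrier G" for i using p(1) by auto
  have le: "d (p i) (p j) = real j - real i" if "i \<le> j" "j \<le> n" for i j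
  proof -
    have "real n \<le> d (p 0) (p i) + d (p i) (p j) + d (p j) (p n)"
      using dist_tri[OF pc[of 0] pc[of i] pc[of n]] dist_tri[OF pc[of i] pc[of j] pc[of n]] p(2-4) by simp
    moreover have "d (p 0) (p i) \<le> real i" "d (p j) (p n) \<le> real n - real j"
      "d (p i) (p j) \<le> real j - real i"
      using path_dist_le[OF p(1) step, where n = n, of 0 i] path_dist_le[OF p(1) step, where n = n, of j n]
        path_dist_le[OF p(1) step, where n = n, of i j] that by simp_all
    ultimately show ?thesis by linarith
  qed
  have "d (p i) (p j) = \<bar>real i - real j\<bar>" if "i \<le> n" "j \<le> n" for i j
    using le[of i j] le[of j i] dist_sym[OF pc[of i] pc[of j]] that by (cases "i \<le> j") simp_all
  then show ?thesis using that p by blast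
qed

section \<open>Busemann points as limits along infinite geodesics\<close>

abbreviation "B \<equiv> busemann_points G d"

lemma busemann_iff:
  "h \<in> B \<longleftrightarrow> h \<in> extensional (carrier G) \<and> (\<exists>\<gamma>. infinite_geodesic G d \<gamma> \<and>
     (\<forall>y\<in>carrier G. (\<lambda>n. d (\<gamma> n) y - d (\<gamma> n) \<one>) \<longlonglongrightarrow> h y))"
  unfolding busemann_points_def limitin_componentwise metric_functional_def
  by (auto simp: infinite_geodesic_def)

text \<open>By the triangle inequality \<open>d (\<gamma> n) y - real n\<close> is nonincreasing in
  \<open>n\<close> and bounded below by \<open>- d (\<gamma> 0) y\<close>. The functionals are
  differences of two such convergent sequences, at \<open>y\<close> and at
  \<open>\<one>\<close>.\<close>

lemma geodesic_limit_exists: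
  assumes g: "infinite_geodesic G d \<gamma>"
  obtains h where "h \<in> B" "\<And>y. y \<in> carrier G \<Longrightarrow> (\<lambda>n. d (\<gamma> n) y - d (\<gamma> n) \<one>) \<longlonglongrightarrow> h y"
proof -
  have c: "\<gamma> n \<in> carrier G" for n using g by (auto simp: infinite_geodesic_def)
  have gd: "d (\<gamma> i) (\<gamma> j) = \<bar>real i - real j\<bar>" for i j using g by (auto simp: infinite_geodesic_def)
  have conv: "convergent (\<lambda>n. d (\<gamma> n) y - real n)" if y: "y \<in> carrier G" for y
  proof -
    have "d (\<gamma> (Suc n)) y \<le> d (\<gamma> n) y + 1" for n
      using dist_tri[of "\<gamma> (Suc n)" "\<gamma> n" y] c y gd[of "Suc n" n] by auto
    then have dec: "decseq (\<lambda>n. d (\<gamma> n) y - real n)"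
      by (intro decseq_SucI) (simp add: algebra_simps)
    have lb: "- d (\<gamma> 0) y \<le> d (\<gamma> n) y - real n" for n
      using dist_tri[of "\<gamma> n" y "\<gamma> 0"] dist_sym[of "\<gamma> 0" y] c y gd[of n 0] by auto
    show ?thesis
      using decseq_convergent[OF dec, of "- d (\<gamma> 0) y"] lb by (metis convergentI)
  qed
  have "convergent (\<lambda>n. d (\<gamma> n) y - d (\<gamma> n) \<one>)" if "y \<in> carrier G" for y
    using convergent_diff[OF conv[OF that] conv[OF one_closed]] by simp
  then have "\<And>y. y \<in> carrier G \<Longrightarrow> (\<lambda>n. d (\<gamma> n) y - d (\<gamma> n) \<one>) \<longlonglongrightarrow>
      (\<lambda>y\<in>carrier G. lim (\<lambda>n. d (\<gamma> n) y - d (\<gamma> n) \<one>)) y"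
    by (simp add: convergent_LIMSEQ_iff)
  moreover from this have "(\<lambda>y\<in>carrier G. lim (\<lambda>n. d (\<gamma> n) y - d (\<gamma> n) \<one>)) \<in> B"
    unfolding busemann_iff using g by blast
  ultimately show ?thesis using that by blast
qed

lemma limit_along_geodesic:
  assumes g: "infinite_geodesic G d \<gamma>"
    and lim: "\<And>y. y \<in> carrier G \<Longrightarrow> (\<lambda>n. d (\<gamma> n) y - d (\<gamma> n) \<one>) \<longlonglongrightarrow> h y"
  shows "h (\<gamma> j) = h (\<gamma> 0) - real j"
proof -
  have c: "\<gamma> n \<in> carrier G" for n using g by (auto simp: infinite_geodesic_def)
  have gd: "d (\<gamma> i) (\<gamma> j) = \<bar>real i - real j\<bar>" for i j using g by (auto simp: infinite_geodesic_def)
  have l: "(\<lambda>n. d (\<gamma> n) (\<gamma> j) - d (\<gamma> n) (\<gamma> 0)) \<longlonglongrightarrow> h (\<gamma> j) - h (\<gamma> 0)"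
    using tendsto_diff[OF lim[OF c[of j]] lim[OF c[of 0]]] by simp
  \<comment> \<open>Past index \<open>j\<close> the difference is \<open>(n - j) - n\<close>, hence
    constant.\<close>
  have "eventually (\<lambda>n. d (\<gamma> n) (\<gamma> j) - d (\<gamma> n) (\<gamma> 0) = - real j) sequentially"
    using eventually_ge_at_top[of j] by eventually_elim (simp add: gd)
  then have "(\<lambda>n. d (\<gamma> n) (\<gamma> j) - d (\<gamma> n) (\<gamma> 0)) \<longlonglongrightarrow> - real j"
    by (rule tendsto_eventually)
  from LIMSEQ_unique[OF l this] show ?thesis by simp
qed

lemma busemann_one: "h \<in> B \<Longrightarrow> h \<one> = 0"
  unfolding busemann_iff by (auto dest!: bspec[OF _ one_closed] simp: LIMSEQ_const_iff)

lemma busemann_lipschitz: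
  assumes "h \<in> B" "y \<in> carrier G" "z \<in> carrier G"
  shows "h y \<le> h z + d y z"
proof -
  obtain \<gamma> where g: "infinite_geodesic G d \<gamma>"
    and lim: "\<And>y. y \<in> carrier G \<Longrightarrow> (\<lambda>n. d (\<gamma> n) y - d (\<gamma> n) \<one>) \<longlonglongrightarrow> h y"
    using assms(1) unfolding busemann_iff by blast
  have c: "\<gamma> n \<in> carrier G" for n using g by (auto simp: infinite_geodesic_def)
  have "d (\<gamma> n) y - d (\<gamma> n) \<one> \<le> (d (\<gamma> n) z - d (\<gamma> n) \<one>) + d y z" for n
    using dist_tri[of "\<gamma> n" z y] dist_sym[of y z] assms c by auto
  then show ?thesis
    by (intro LIMSEQ_le[OF lim[OF assms(2)] tendsto_add[OF lim[OF assms(3)] tendsto_const]]) auto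
qed

section \<open>The group action on Busemann points and its kernel\<close>

definition trans_fun :: "'a \<Rightarrow> ('a \<Rightarrow> real) \<Rightarrow> 'a \<Rightarrow> real" where
  "trans_fun g h = (\<lambda>y\<in>carrier G. h (g \<otimes> y) - h g)"

text \<open>If \<open>h\<close> is the limit along \<open>\<gamma>\<close>, then by left invariance
  \<open>trans_fun g h\<close> is the limit along the translated geodesic
  \<open>inv g \<otimes> \<gamma> n\<close>; subtracting \<open>h g\<close> restores the value 0 at
  the identity.\<close>

lemma trans_fun_busemann:
  assumes "h \<in> B" "g \<in> carrier G"
  shows "trans_fun g h \<in> B"
proof -
  obtain \<gamma> where g: "infinite_geodesic G d \<gamma>"
    and lim: "\<And>y. y \<in> carrier G \<Longrightarrow> (\<lambda>n. d (\<gamma> n) y - d (\<gamma> n) \<one>) \<longlonglongrightarrow> h y"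
    using assms(1) unfolding busemann_iff by blast
  have c: "\<gamma> n \<in> carrier G" for n using g by (auto simp: infinite_geodesic_def)
  have shift: "d (inv g \<otimes> \<gamma> n) y = d (\<gamma> n) (g \<otimes> y)" if "y \<in> carrier G" for n y
    using dist_left[of g "inv g \<otimes> \<gamma> n" y] assms(2) c[of n] that by (simp add: m_assoc[symmetric])
  have "infinite_geodesic G d (\<lambda>n. inv g \<otimes> \<gamma> n)"
    using g assms(2) c by (auto simp: infinite_geodesic_def dist_left)
  moreover have "(\<lambda>n. d (inv g \<otimes> \<gamma> n) y - d (inv g \<otimes> \<gamma> n) \<one>) \<longlonglongrightarrow> trans_fun g h y"
    if y: "y \<in> carrier G" for y
    using tendsto_diff[OF lim[of "g \<otimes> y"] lim[of g]] y assms(2)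
    by (simp add: shift trans_fun_def)
  ultimately show ?thesis
    unfolding busemann_iff by (auto simp: trans_fun_def)
qed

text \<open>The condition on \<open>h\<close> says \<open>trans_fun x h = h\<close>, so this is the
  kernel of the action on \<open>B\<close>. On it each Busemann point is a homomorphism to the
  reals.\<close>

definition stabilizer :: "'a set" where
  "stabilizer = {x \<in> carrier G. \<forall>h\<in>B. \<forall>y\<in>carrier G. h (x \<otimes> y) = h x + h y}"

lemma stabilizer_carrier: "x \<in> stabilizer \<Longrightarrow> x \<in> carrier G"
  and stabilizer_add: "x \<in> stabilizer \<Longrightarrow> h \<in> B \<Longrightarrow> y \<in> carrier G \<Longrightarrow> h (x \<otimes> y) = h x + h y"
  by (auto simp: stabilizer_def)

lemma stabilizer_pow:
  assumes "x \<in> stabilizer" "h \<in> B" "y \<in> carrier G"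
  shows "h (x [^] (n::nat) \<otimes> y) = real n * h x + h y"
  using assms(3)
proof (induction n arbitrary: y)
  case (Suc n)
  then show ?case
    using stabilizer_carrier[OF assms(1)] stabilizer_add[OF assms(1,2), of y]
    by (simp add: m_assoc algebra_simps)
qed auto

lemma stabilizer_inv:
  assumes "x \<in> stabilizer"
  shows "inv x \<in> stabilizer" and "h \<in> B \<Longrightarrow> h (inv x) = - h x"
proof -
  have x: "x \<in> carrier G" using assms by (rule stabilizer_carrier)
  have *: "h (inv x \<otimes> y) = h y - h x" if "h \<in> B" "y \<in> carrier G" for h y
    using stabilizer_add[OF assms that(1), of "inv x \<otimes> y"] x that by (simp add: m_assoc[symmetric])
  have **: "h (inv x) = - h x" if "h \<in> B" for h
    using *[OF that one_closed] busemann_one[OF that] x by simp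
  show "h \<in> B \<Longrightarrow> h (inv x) = - h x" by (rule **)
  show "inv x \<in> stabilizer" unfolding stabilizer_def using x by (simp add: * **)
qed

text \<open>Cutting off outside \<open>B\<close> makes each \<open>act g\<close> an extensional
  self-map of \<open>B\<close>; there are only finitely many of these once \<open>B\<close> is
  finite.\<close>

definition act :: "'a \<Rightarrow> ('a \<Rightarrow> real) \<Rightarrow> 'a \<Rightarrow> real" where
  "act g = restrict (trans_fun g) B"

lemma act_eq_imp_stabilizer:
  assumes a: "a \<in> carrier G" and g: "g \<in> carrier G" and eq: "act a = act g"
  shows "g \<otimes> inv a \<in> stabilizer"
proof -
  have e: "h (g \<otimes> inv a \<otimes> z) = h z - h a + h g" if "h \<in> B" "z \<in> carrier G" for h z
  proof -
    \<comment> \<open>At the point \<open>inv a \<otimes> z\<close> the left side is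
      \<open>h z - h a\<close> and the right side is
      \<open>h (g \<otimes> inv a \<otimes> z) - h g\<close>.\<close>
    have "trans_fun a h (inv a \<otimes> z) = trans_fun g h (inv a \<otimes> z)"
      using eq that(1) unfolding act_def by (metis restrict_apply')
    then show ?thesis
      using a g that(2) by (simp add: trans_fun_def m_assoc[symmetric])
  qed
  have "h (g \<otimes> inv a) = - h a + h g" if "h \<in> B" for h
    using e[OF that one_closed] busemann_one[OF that] a g by simp
  then have "h (g \<otimes> inv a \<otimes> z) = h (g \<otimes> inv a) + h z" if "h \<in> B" "z \<in> carrier G" for h z
    using e[OF that] that(1) by simp
  then show ?thesis using a g by (simp add: stabilizer_def)
qed

end

section \<open>Finitely many Busemann points: finite index and agreement on the stabilizer\<close>

locale finite_busemann = geodesic_group +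
  assumes finB: "finite B"
begin

lemma finite_act: "finite (act ` carrier G)"
proof (rule finite_subset)
  show "act ` carrier G \<subseteq> B \<rightarrow>\<^sub>E B"
    by (auto simp: act_def trans_fun_busemann)
qed (use finB in \<open>auto intro: finite_PiE\<close>)

lemma stabilizer_finite_index:
  obtains D where "\<And>g. g \<in> carrier G \<Longrightarrow> \<exists>u\<in>stabilizer. \<exists>a\<in>carrier G. g = u \<otimes> a \<and> d \<one> a \<le> D"
proof -
  obtain C where C: "C \<subseteq> carrier G" "finite C" "act ` carrier G = act ` C"
    using finite_subset_image[OF finite_act, of act "carrier G"] by blast
  \<comment> \<open>\<open>C\<close> holds representatives of all induced maps. Lengths are
    nonnegative, so their sum bounds each of them.\<close>
  define D where "D = (\<Sum>a\<in>C. d \<one> a)"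
  have D: "d \<one> a \<le> D" if "a \<in> C" for a
    unfolding D_def using that C by (intro member_le_sum) (auto intro: dist_nonneg)
  show ?thesis
  proof (rule that)
    fix g assume g: "g \<in> carrier G"
    then obtain a where a: "a \<in> C" "act a = act g" using C(3) by (metis imageE imageI)
    then have "g \<otimes> inv a \<in> stabilizer" "a \<in> carrier G" using act_eq_imp_stabilizer g C by auto
    moreover have "g = g \<otimes> inv a \<otimes> a" using g \<open>a \<in> carrier G\<close> by (simp add: m_assoc)
    ultimately show "\<exists>u\<in>stabilizer. \<exists>a\<in>carrier G. g = u \<otimes> a \<and> d \<one> a \<le> D"
      using D[OF a(1)] by blast
  qed
qed

text \<open>The window length for the pigeonhole argument: \<open>num_actions\<close> steps visit
  \<open>num_actions + 1\<close> points, so two of them act alike on \<open>B\<close>.\<close>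

definition num_actions :: nat where "num_actions = card (act ` carrier G)"

text \<open>Along the powers of \<open>x\<close> both functions grow linearly, with slopes
  \<open>f x\<close> and \<open>h x\<close>. A bounded excess of \<open>f\<close> over
  \<open>h\<close> gives \<open>f x \<le> h x\<close>; the same for \<open>inv x\<close> reverses
  the inequality.\<close>

lemma eq_on_stabilizer_if_le:
  assumes f: "f \<in> B" "h \<in> B" and le: "\<And>y. y \<in> carrier G \<Longrightarrow> f y \<le> c + h y" and x: "x \<in> stabilizer"
  shows "f x = h x"
proof -
  have le1: "f x \<le> h x" if x: "x \<in> stabilizer" for x
  proof (rule ccontr)
    assume "\<not> f x \<le> h x"
    then obtain n where n: "real n * (f x - h x) > c"
      using reals_Archimedean3[of "f x - h x"] by auto
    have "f (x [^] n \<otimes> \<one>) \<le> c + h (x [^] n \<otimes> \<one>)"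
      using stabilizer_carrier[OF x] by (intro le) auto
    then show False
      using n unfolding stabilizer_pow[OF x f(1) one_closed] stabilizer_pow[OF x f(2) one_closed]
      by (simp add: busemann_one f algebra_simps)
  qed
  show ?thesis
    using le1[OF x] le1[OF stabilizer_inv(1)[OF x]] stabilizer_inv(2)[OF x f(1)] stabilizer_inv(2)[OF x f(2)] by simp
qed

text \<open>The indices \<open>i\<close>, \<open>j\<close>, the element \<open>t\<close> and the
  geodesic \<open>\<sigma>\<close> are found from the window \<open>g\<close> alone. Its limit
  \<open>h\<close> therefore serves \<open>f\<close> and \<open>f'\<close> alike, and both coincide
  with \<open>h\<close> on the stabilizer.\<close>

lemma decreasing_agree:
  assumes g: "range g \<subseteq> carrier G" and step: "\<And>i. i < num_actions \<Longrightarrow> d (g i) (g (Suc i)) \<le> 1"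
    and f: "f \<in> B" "\<And>i. i \<le> num_actions \<Longrightarrow> f (g i) = f (g 0) - real i"
    and f': "f' \<in> B" "\<And>i. i \<le> num_actions \<Longrightarrow> f' (g i) = f' (g 0) - real i"
    and x: "x \<in> stabilizer"
  shows "f x = f' x"
proof -
  have gc: "g i \<in> carrier G" for i using g by auto
  have "\<not> inj_on (act \<circ> g) {..num_actions}"
  proof
    assume "inj_on (act \<circ> g) {..num_actions}"
    then have "card {..num_actions} \<le> card (act ` carrier G)"
      using gc by (intro card_inj_on_le[OF _ _ finite_act]) auto
    then show False by (simp add: num_actions_def)
  qed
  then obtain i j where ij: "i < j" "j \<le> num_actions" "act (g i) = act (g j)"
    unfolding inj_on_def by (metis atMost_iff comp_apply linorder_neqE_nat)
  define t where "t = g j \<otimes> inv (g i)"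
  define l where "l = j - i"
  have l: "l > 0" "j = i + l" using ij by (auto simp: l_def)
  have tH: "t \<in> stabilizer" unfolding t_def using act_eq_imp_stabilizer[OF gc gc ij(3)] .
  have tc: "t \<in> carrier G" using tH by (rule stabilizer_carrier)
  have tg: "t \<otimes> g i = g j" unfolding t_def using gc by (simp add: m_assoc)
  \<comment> \<open>The translates of the piece from \<open>g i\<close> to \<open>g j\<close> by powers of \<open>t\<close>, traversed one after the other.\<close>
  define \<sigma> where "\<sigma> m = t [^] (m div l) \<otimes> g (i + m mod l)" for m
  have sc: "\<sigma> m \<in> carrier G" for m using tc gc by (simp add: \<sigma>_def)
  have s_step: "d (\<sigma> m) (\<sigma> (Suc m)) \<le> 1" for m
  proof -
    have "i + m mod l < num_actions" using ij l mod_less_divisor[OF l(1), of m] by linarith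
    note st = step[OF this]
    \<comment> \<open>This covers the seam too: the next translate starts at
      \<open>t \<otimes> g i = g j\<close>, the end of the current piece.\<close>
    have "\<sigma> (Suc m) = t [^] (m div l) \<otimes> g (Suc (i + m mod l))"
    proof (cases "Suc (m mod l) = l")
      case True
      then have "\<sigma> (Suc m) = t [^] (m div l) \<otimes> (t \<otimes> g i)"
        using tc gc by (simp add: \<sigma>_def div_Suc mod_Suc m_assoc)
      then show ?thesis using True l by (simp add: tg flip: add_Suc_right)
    next
      case False
      then show ?thesis by (simp add: \<sigma>_def div_Suc mod_Suc)
    qed
    then show ?thesis using st tc gc by (simp add: \<sigma>_def dist_left)
  qed
  have dec: "\<phi> (\<sigma> m) = \<phi> (g i) - real m"
    if p: "\<phi> \<in> B" "\<And>i. i \<le> num_actions \<Longrightarrow> \<phi> (g i) = \<phi> (g 0) - real i" for \<phi> m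
  proof -
    \<comment> \<open>Additivity gives \<open>\<phi> (g j) = \<phi> t + \<phi> (g i)\<close>, and
      \<open>\<phi>\<close> drops by \<open>l\<close> from \<open>g i\<close> to \<open>g j\<close>.
      Each further factor \<open>t\<close> then repeats this drop.\<close>
    have "\<phi> t = - real l"
      using stabilizer_add[OF tH p(1) gc[of i]] p(2)[of i] p(2)[of j] ij l tg by simp
    moreover have "i + m mod l \<le> num_actions" using ij l mod_less_divisor[OF l(1), of m] by linarith
    ultimately have "\<phi> (\<sigma> m) = - (real (m div l) * real l + real (m mod l)) + \<phi> (g i)"
      using p(2)[of i] p(2)[of "i + m mod l"] ij
      by (simp add: \<sigma>_def stabilizer_pow[OF tH p(1) gc])
    also have "real (m div l) * real l + real (m mod l) = real m"
      by (metis div_mult_mod_eq of_nat_add of_nat_mult)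
    finally show ?thesis by simp
  qed
  \<comment> \<open>Unit steps bound the distance above; the 1-Lipschitz function \<open>f\<close>,
    which falls by \<open>n - m\<close>, bounds it below.\<close>
  have sle: "d (\<sigma> m) (\<sigma> n) = real n - real m" if "m \<le> n" for m n
  proof -
    have "d (\<sigma> m) (\<sigma> n) \<le> real n - real m"
      using path_dist_le[of \<sigma> n m n] sc s_step that by auto
    moreover have "f (\<sigma> m) \<le> f (\<sigma> n) + d (\<sigma> m) (\<sigma> n)"
      using busemann_lipschitz f sc by blast
    ultimately show ?thesis using dec[OF f] by simp
  qed
  have "d (\<sigma> m) (\<sigma> n) = \<bar>real m - real n\<bar>" for m n
    using sle[of m n] sle[of n m] dist_sym[OF sc sc, of m n] by (cases "m \<le> n") auto
  then have geo: "infinite_geodesic G d \<sigma>" using sc by (auto simp: infinite_geodesic_def)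
  obtain h where h: "h \<in> B" "\<And>y. y \<in> carrier G \<Longrightarrow> (\<lambda>n. d (\<sigma> n) y - d (\<sigma> n) \<one>) \<longlonglongrightarrow> h y"
    using geodesic_limit_exists[OF geo] by blast
  have "\<phi> x = h x"
    if p: "\<phi> \<in> B" "\<And>i. i \<le> num_actions \<Longrightarrow> \<phi> (g i) = \<phi> (g 0) - real i" for \<phi>
  proof (rule eq_on_stabilizer_if_le[OF p(1) h(1) _ x])
    fix y assume y: "y \<in> carrier G"
    \<comment> \<open>The Lipschitz bound at \<open>\<sigma> n\<close> gives
      \<open>\<phi> y \<le> \<phi> (g i) - n + d (\<sigma> n) y\<close>, and
      \<open>d (\<sigma> n) \<one> \<le> n + d (\<sigma> 0) \<one>\<close>. The terms in
      \<open>n\<close> cancel, leaving a constant independent of \<open>n\<close> and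
      \<open>y\<close>.\<close>
    have "\<phi> y - (\<phi> (g i) + d (\<sigma> 0) \<one>) \<le> d (\<sigma> n) y - d (\<sigma> n) \<one>" for n
      using busemann_lipschitz[OF p(1) y sc[of n]] dist_sym[OF y sc[of n]] dec[OF p, of n]
        dist_tri[OF sc[of n] sc[of 0] one_closed] sle[of 0 n] dist_sym[OF sc[of n] sc[of 0]]
      by simp
    then have "\<phi> y - (\<phi> (g i) + d (\<sigma> 0) \<one>) \<le> h y"
      by (intro LIMSEQ_le_const[OF h(2)[OF y]]) auto
    then show "\<phi> y \<le> (\<phi> (g i) + d (\<sigma> 0) \<one>) + h y" by simp
  qed
  from this[OF f] this[OF f'] show ?thesis by simp
qed

end

section \<open>Compactness: Busemann points descending along initial windows of long
  geodesics\<close>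

lemma sequence_compactness:
  fixes q :: "nat \<Rightarrow> nat \<Rightarrow> 'c"
  assumes fin: "\<And>i. finite (range (\<lambda>m. q m i))"
  obtains \<gamma> where "\<And>n. \<exists>m\<ge>n. \<forall>i\<le>n. q m i = \<gamma> i"
proof -
  have ex: "\<exists>J\<subseteq>I. infinite J \<and> (\<exists>c. \<forall>m\<in>J. q m n = c)" if "infinite I" for I :: "nat set" and n
  proof -
    have "finite ((\<lambda>m. q m n) ` I)" using fin by (rule finite_subset[rotated]) auto
    from pigeonhole_infinite[OF that this] obtain a where
      "infinite {b \<in> I. q b n = q a n}" by blast
    then show ?thesis by (intro exI[of _ "{b \<in> I. q b n = q a n}"]) auto
  qed
  \<comment> \<open>Nested infinite index sets, the \<open>n\<close>-th making coordinate
    \<open>n\<close> constant. Any \<open>m\<close> in \<open>I n\<close> then has the right values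
    at all coordinates up to \<open>n\<close>.\<close>
  have "\<exists>I. \<forall>n. (infinite (I n) \<and> (\<exists>c. \<forall>m\<in>I n. q m n = c)) \<and> I (Suc n) \<subseteq> I n"
  proof (rule dependent_nat_choice)
    show "\<exists>I. infinite I \<and> (\<exists>c. \<forall>m\<in>I. q m 0 = c)"
      using ex[of UNIV 0] by auto
  next
    fix I :: "nat set" and n
    assume "infinite I \<and> (\<exists>c. \<forall>m\<in>I. q m n = c)"
    then show "\<exists>J. (infinite J \<and> (\<exists>c. \<forall>m\<in>J. q m (Suc n) = c)) \<and> J \<subseteq> I"
      using ex[of I "Suc n"] by blast
  qed
  then obtain I where I: "\<And>n. infinite (I n)" "\<And>n. \<exists>c. \<forall>m\<in>I n. q m n = c" "\<And>n. I (Suc n) \<subseteq> I n"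
    by blast
  obtain \<gamma> where \<gamma>: "\<And>n m. m \<in> I n \<Longrightarrow> q m n = \<gamma> n" using I(2) by metis
  have mono: "I n \<subseteq> I i" if "i \<le> n" for i n using lift_Suc_antimono_le[of I, OF I(3) that] .
  show ?thesis
  proof (rule that)
    fix n
    obtain m where "m \<in> I n" "m \<ge> n" using I(1)[of n] unfolding infinite_nat_iff_unbounded_le by blast
    then show "\<exists>m\<ge>n. \<forall>i\<le>n. q m i = \<gamma> i" using \<gamma> mono by blast
  qed
qed

context geodesic_group
begin

definition geodesic_upto :: "nat \<Rightarrow> (nat \<Rightarrow> 'a) \<Rightarrow> bool" where
  "geodesic_upto n p \<longleftrightarrow> range p \<subseteq> carrier G \<and> (\<forall>i\<le>n. \<forall>j\<le>n. d (p i) (p j) = \<bar>real i - real j\<bar>)"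

definition descends :: "nat \<Rightarrow> (nat \<Rightarrow> 'a) \<Rightarrow> ('a \<Rightarrow> real) \<Rightarrow> bool" where
  "descends k p f \<longleftrightarrow> (\<forall>j\<le>k. f (p j) = f (p 0) - real j)"

text \<open>Otherwise there are counterexamples of every length from \<open>k\<close> on. Starting
  at \<open>\<one>\<close>, they have their \<open>i\<close>-th vertices in a finite ball, so a
  limiting infinite geodesic exists; its Busemann point descends along a counterexample sharing its
  first \<open>k\<close> steps.\<close>

lemma geodesic_descends_from_one:
  "\<exists>M\<ge>k. \<forall>p. geodesic_upto M p \<and> p 0 = \<one> \<longrightarrow> (\<exists>f\<in>B. descends k p f)"
proof (rule ccontr)
  assume "\<not> ?thesis"
  then have "\<forall>M. \<exists>p. M \<ge> k \<longrightarrow> geodesic_upto M p \<and> p 0 = \<one> \<and> \<not> (\<exists>f\<in>B. descends k p f)"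
    by blast
  from choice[OF this] obtain p where p:
    "\<And>M. M \<ge> k \<Longrightarrow> geodesic_upto M (p M)" "\<And>M. M \<ge> k \<Longrightarrow> p M 0 = \<one>"
    and not_descends: "\<And>M. M \<ge> k \<Longrightarrow> \<not> (\<exists>f\<in>B. descends k (p M) f)"
    by blast
  have pc: "p M i \<in> carrier G" if "M \<ge> k" for M i
    using p(1)[OF that] by (auto simp: geodesic_upto_def)
  have pd: "d (p M i) (p M j) = \<bar>real i - real j\<bar>" if "M \<ge> k" "i \<le> M" "j \<le> M" for M i j
    using p(1)[OF that(1)] that(2,3) by (auto simp: geodesic_upto_def)
  \<comment> \<open>The shift by \<open>k\<close> makes every \<open>m\<close> a legitimate index.
    Entries beyond the controlled length \<open>m + k\<close> are reset to \<open>\<one>\<close>, so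
    that each coordinate stays in a finite ball.\<close>
  define q where "q m i = (if i \<le> m + k then p (m + k) i else \<one>)" for m i
  have qc: "q m i \<in> carrier G" for m i using pc[of "m + k"] by (simp add: q_def)
  have "d \<one> (q m i) \<le> real i" for m i
    using p(2)[of "m + k"] pd[of "m + k" 0 i] dist_refl by (auto simp: q_def)
  then have "range (\<lambda>m. q m i) \<subseteq> {x \<in> carrier G. d \<one> x \<le> real i}" for i using qc by auto
  then have "finite (range (\<lambda>m. q m i))" for i using finite_ball by (rule finite_subset)
  then obtain \<gamma> where \<gamma>: "\<And>n. \<exists>m\<ge>n. \<forall>i\<le>n. q m i = \<gamma> i"
    using sequence_compactness by blast
  have "\<gamma> i \<in> carrier G" for i using \<gamma>[of i] qc by (metis order_refl)
  moreover have "d (\<gamma> i) (\<gamma> j) = \<bar>real i - real j\<bar>" for i j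
  proof -
    obtain m where m: "m \<ge> max i j" "\<forall>i'\<le>max i j. q m i' = \<gamma> i'" using \<gamma> by blast
    then have "q m i = \<gamma> i" "q m j = \<gamma> j" by simp_all
    then have "\<gamma> i = p (m + k) i" "\<gamma> j = p (m + k) j" using m(1) by (simp_all add: q_def)
    then show ?thesis using pd[of "m + k" i j] m by auto
  qed
  ultimately have geo: "infinite_geodesic G d \<gamma>" by (auto simp: infinite_geodesic_def)
  obtain h where h: "h \<in> B" "\<And>y. y \<in> carrier G \<Longrightarrow> (\<lambda>n. d (\<gamma> n) y - d (\<gamma> n) \<one>) \<longlonglongrightarrow> h y"
    using geodesic_limit_exists[OF geo] by blast
  obtain m where m: "m \<ge> k" "\<forall>i\<le>k. q m i = \<gamma> i" using \<gamma> by blast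
  have "p (m + k) i = \<gamma> i" if "i \<le> k" for i
  proof -
    have "q m i = \<gamma> i" using m(2) that by blast
    then show ?thesis using that by (simp add: q_def)
  qed
  moreover have "h (\<gamma> j) = h (\<gamma> 0) - real j" for j
    using limit_along_geodesic[OF geo h(2)] .
  ultimately have "descends k (p (m + k)) h"
    unfolding descends_def by (metis le0)
  then have "\<exists>f\<in>B. descends k (p (m + k)) f" using h(1) by (rule bexI)
  with not_descends[OF le_add2] show False by (rule notE)
qed

text \<open>Left translation moves the starting point to \<open>\<one>\<close>, and the action
  carries the resulting Busemann point back. Thus \<open>M\<close> is uniform over starting
  points.\<close>

lemma geodesic_descends:
  obtains M where "M \<ge> k" "\<And>p. geodesic_upto M p \<Longrightarrow> \<exists>f\<in>B. descends k p f"
proof -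
  obtain M where M: "M \<ge> k" "\<And>p. geodesic_upto M p \<Longrightarrow> p 0 = \<one> \<Longrightarrow> \<exists>f\<in>B. descends k p f"
    using geodesic_descends_from_one[of k] by blast
  show ?thesis
  proof (rule that[OF M(1)])
    fix p assume p: "geodesic_upto M p"
    then have pc: "p i \<in> carrier G" for i by (auto simp: geodesic_upto_def)
    have "geodesic_upto M (\<lambda>j. inv (p 0) \<otimes> p j)"
      using p pc by (auto simp: geodesic_upto_def dist_left)
    then obtain f where f: "f \<in> B" "descends k (\<lambda>j. inv (p 0) \<otimes> p j) f"
      using M(2)[of "\<lambda>j. inv (p 0) \<otimes> p j"] pc by auto
    have "descends k p (trans_fun (inv (p 0)) f)"
      using f(2) pc by (simp add: descends_def trans_fun_def)
    then show "\<exists>f\<in>B. descends k p f"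
      using trans_fun_busemann[OF f(1)] pc by blast
  qed
qed

section \<open>Busemann points are boundary points\<close>

lemma busemann_subset_boundary: "B \<subseteq> metric_boundary G d"
proof
  fix h assume hB: "h \<in> B"
  obtain \<gamma> where g: "infinite_geodesic G d \<gamma>"
    and lt: "limitin (powertop_real (carrier G)) (\<lambda>n. metric_functional G d (\<gamma> n)) h sequentially"
    using hB unfolding busemann_points_def by blast
  have lim: "(\<lambda>n. d (\<gamma> n) y - d (\<gamma> n) \<one>) \<longlonglongrightarrow> h y" if "y \<in> carrier G" for y
    using lt that unfolding limitin_componentwise metric_functional_def by auto
  have c: "\<gamma> n \<in> carrier G" for n using g by (auto simp: infinite_geodesic_def)
  have "h \<in> metric_compactification G d"
    unfolding metric_compactification_def
  proof (rule limitin_closedin[OF lt closedin_closure_of])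
    have "metric_functional G d ` carrier G \<subseteq> topspace (powertop_real (carrier G))"
      by (auto simp: metric_functional_def)
    from closure_of_subset[OF this]
    show "\<forall>\<^sub>F n in sequentially. metric_functional G d (\<gamma> n) \<in>
        powertop_real (carrier G) closure_of metric_functional G d ` carrier G"
      using c by (intro always_eventually) blast
  qed simp
  \<comment> \<open>A functional of a group element is bounded below by \<open>- d x \<one>\<close>,
    whereas \<open>h\<close> tends to minus infinity along its geodesic.\<close>
  moreover have "h \<noteq> metric_functional G d x" if x: "x \<in> carrier G" for x
  proof
    assume eq: "h = metric_functional G d x"
    obtain n where "real n > h (\<gamma> 0) + d x \<one>" using reals_Archimedean2 by blast
    then have "h (\<gamma> n) < - d x \<one>"
      using limit_along_geodesic[OF g lim, of n] by simp
    moreover have "h (\<gamma> n) = d x (\<gamma> n) - d x \<one>"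
      using c eq by (simp add: metric_functional_def)
    ultimately show False using dist_nonneg[OF x c[of n]] by simp
  qed
  ultimately show "h \<in> metric_boundary G d" unfolding metric_boundary_def by blast
qed

end

section \<open>Bounding the length of annihilated elements\<close>

context finite_busemann
begin

lemma annihilator_bounded:
  obtains R where "\<And>x. x \<in> annihilator G B \<Longrightarrow> d \<one> x \<le> R"
proof -
  obtain D where D: "\<And>g. g \<in> carrier G \<Longrightarrow> \<exists>u\<in>stabilizer. \<exists>a\<in>carrier G. g = u \<otimes> a \<and> d \<one> a \<le> D"
    using stabilizer_finite_index by blast
  obtain k0 where k0: "real k0 \<ge> 4 * D + 1" using real_arch_simple by blast
  \<comment> \<open>The first bound lets a drop of \<open>k\<close> survive a comparison error of
    \<open>4 * D\<close> with at least 1 left. The second makes windows starting at \<open>i\<close>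
    and \<open>Suc i\<close> share at least \<open>num_actions\<close> steps.\<close>
  define k where "k = max k0 (Suc num_actions)"
  have k: "real k \<ge> 4 * D + 1" "num_actions < k" using k0 by (auto simp: k_def)
  obtain M where M: "M \<ge> k" "\<And>p. geodesic_upto M p \<Longrightarrow> \<exists>f\<in>B. descends k p f"
    using geodesic_descends[of k] by blast
  \<comment> \<open>Writing \<open>w = u \<otimes> a\<close> with \<open>u\<close> in the stabilizer
    and \<open>a\<close> of length at most \<open>D\<close>, the parts at \<open>u\<close> cancel,
    so \<open>h\<close> and \<open>f\<close> differ by at most \<open>2 * D\<close> at
    \<open>w\<close>. Two points double the error.\<close>
  have cmp: "h y - h z \<le> f y - f z + 4 * D"
    if hf: "h \<in> B" "f \<in> B" "\<And>u. u \<in> stabilizer \<Longrightarrow> h u = f u"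
      and yz: "y \<in> carrier G" "z \<in> carrier G" for h f y z
  proof -
    have small: "\<bar>\<phi> a\<bar> \<le> D" if "\<phi> \<in> B" "a \<in> carrier G" "d \<one> a \<le> D" for \<phi> a
      using busemann_lipschitz[OF that(1,2) one_closed] busemann_lipschitz[OF that(1) one_closed that(2)]
        busemann_one[OF that(1)] dist_sym[OF one_closed that(2)] that(3) by simp
    have key: "\<exists>u\<in>stabilizer. \<exists>a\<in>carrier G. (\<forall>\<phi>\<in>B. \<phi> w = \<phi> u + \<phi> a) \<and> \<bar>h a\<bar> \<le> D \<and> \<bar>f a\<bar> \<le> D"
      if "w \<in> carrier G" for w
      using D[OF that] stabilizer_add small hf(1,2) by metis
    have "\<bar>h w - f w\<bar> \<le> 2 * D" if w: "w \<in> carrier G" for w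
    proof -
      obtain u a where "u \<in> stabilizer" "\<forall>\<phi>\<in>B. \<phi> w = \<phi> u + \<phi> a" "\<bar>h a\<bar> \<le> D" "\<bar>f a\<bar> \<le> D"
        using key[OF w] by blast
      moreover from this have "h w = h u + h a" "f w = f u + f a" "h u = f u" using hf by blast+
      ultimately show ?thesis by linarith
    qed
    from this[OF yz(1)] this[OF yz(2)] show ?thesis by linarith
  qed
  show ?thesis
  proof (rule that)
    fix x assume "x \<in> annihilator G B"
    then have x: "x \<in> carrier G" "\<And>h. h \<in> B \<Longrightarrow> h x = 0" by (auto simp: annihilator_def)
    obtain L p where p: "range p \<subseteq> carrier G" "p 0 = \<one>" "p L = x" "d \<one> x = real L"
      and pd: "\<And>i j. i \<le> L \<Longrightarrow> j \<le> L \<Longrightarrow> d (p i) (p j) = \<bar>real i - real j\<bar>"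
      using geodesic_exists[OF one_closed x(1)] by metis
    have pc: "p i \<in> carrier G" for i using p(1) by auto
    \<comment> \<open>With \<open>J\<close> full windows before the last \<open>M\<close> steps,
      \<open>f 0\<close> sinks to \<open>-J\<close> or lower, and the tail of fewer than
      \<open>M + k\<close> steps must bring it back to 0 at \<open>x\<close>. Hence
      \<open>J \<le> M + k\<close>, while \<open>L < M + k * (J + 1)\<close>.\<close>
    show "d \<one> x \<le> real (M + k * (M + k + 1))"
    proof (rule ccontr)
      assume "\<not> ?thesis"
      then have LM: "L > M + k * (M + k + 1)" using p(4) by linarith
      have "\<exists>f\<in>B. \<forall>j\<le>k. f (p (i + j)) = f (p i) - real j" if "i + M \<le> L" for i
        using M(2)[of "\<lambda>j. p (i + j)"] that pd pc
        by (simp add: geodesic_upto_def descends_def image_subset_iff)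
      then have "\<exists>f. \<forall>i. i + M \<le> L \<longrightarrow> f i \<in> B \<and> (\<forall>j\<le>k. f i (p (i + j)) = f i (p i) - real j)"
        by metis
      then obtain f where f: "\<And>i. i + M \<le> L \<Longrightarrow> f i \<in> B"
        "\<And>i j. i + M \<le> L \<Longrightarrow> j \<le> k \<Longrightarrow> f i (p (i + j)) = f i (p i) - real j" by blast
      have agree: "i + M \<le> L \<longrightarrow> (\<forall>u\<in>stabilizer. f 0 u = f i u)" for i
      proof (induction i)
        case (Suc i)
        show ?case
        proof (intro impI ballI)
          fix u assume i: "Suc i + M \<le> L" and u: "u \<in> stabilizer"
          have "f i u = f (Suc i) u"
          proof (rule decreasing_agree[of "\<lambda>j. p (Suc i + j)"])
            show "range (\<lambda>j. p (Suc i + j)) \<subseteq> carrier G" using p(1) by auto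
            show "d (p (Suc i + j)) (p (Suc i + Suc j)) \<le> 1" if "j < num_actions" for j
              using pd[of "Suc i + j" "Suc i + Suc j"] that i k M(1) by simp
            show "f i (p (Suc i + j)) = f i (p (Suc i + 0)) - real j" if "j \<le> num_actions" for j
              using f(2)[of i "Suc j"] f(2)[of i 1] that i k by simp
            show "f (Suc i) (p (Suc i + j)) = f (Suc i) (p (Suc i + 0)) - real j" if "j \<le> num_actions" for j
              using f(2)[of "Suc i" j] that i k by simp
          qed (use f(1) i u in auto)
          then show "f 0 u = f (Suc i) u" using Suc i u by simp
        qed
      qed simp
      have f0: "f 0 \<in> B" using f(1)[of 0] LM by simp
      have drop: "f 0 (p (i + k)) \<le> f 0 (p i) - 1" if "i + M \<le> L" for i
        using cmp[OF f0 f(1)[OF that] _ pc[of "i + k"] pc[of i]] agree that f(2)[OF that, of k] k(1) by force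
      \<comment> \<open>The slack \<open>k\<close> on the right is right for the induction: only the
        start of the last window, not its end, needs \<open>M\<close> further steps ahead.\<close>
      have "j * k + M \<le> L + k \<longrightarrow> f 0 (p (j * k)) \<le> - real j" for j
      proof (induction j)
        case 0
        show ?case using busemann_one[OF f0] p(2) by simp
      next
        case (Suc j)
        show ?case using Suc drop[of "j * k"] by (auto simp: algebra_simps)
      qed
      moreover define J where "J = (L - M) div k"
      have "k > 0" using k(2) by simp
      then have J: "J * k \<le> L - M" "L - M < J * k + k"
        unfolding J_def using dividend_less_div_times[of k "L - M"] by auto
      ultimately have "f 0 (p (J * k)) \<le> - real J" using LM by (auto dest!: spec[of _ J])
      moreover have "f 0 x \<le> f 0 (p (J * k)) + d x (p (J * k))"
        using busemann_lipschitz[OF f0 x(1) pc] .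
      moreover have "d x (p (J * k)) = real L - real (J * k)"
      proof -
        have "J * k \<le> L" using J by linarith
        then have "real (J * k) \<le> real L" by (rule of_nat_mono)
        then show ?thesis using pd[of L "J * k"] p(3) \<open>J * k \<le> L\<close> by simp
      qed
      \<comment> \<open>Since \<open>f 0 x = 0\<close>, the 1-Lipschitz bound says that
        \<open>x\<close> is at distance at least \<open>J\<close> from
        \<open>p (J * k)\<close>.\<close>
      ultimately have "real J + real (J * k) \<le> real L" using x(2)[OF f0] by linarith
      then have "J + J * k \<le> L" by (metis of_nat_add of_nat_le_iff)
      then have "J \<le> M + k" using J LM by linarith
      then have "J * k + k \<le> (M + k) * k + k" by simp
      then show False using J LM by (simp add: algebra_simps)
    qed
  qed
qed

lemma finite_annihilator_boundary: "finite (annihilator G (metric_boundary G d))"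
proof -
  obtain R where R: "\<And>x. x \<in> annihilator G B \<Longrightarrow> d \<one> x \<le> R" using annihilator_bounded by blast
  have "annihilator G (metric_boundary G d) \<subseteq> annihilator G B"
    using busemann_subset_boundary by (auto simp: annihilator_def)
  also have "\<dots> \<subseteq> {x \<in> carrier G. d \<one> x \<le> R}" using R by (auto simp: annihilator_def)
  finally show ?thesis using finite_ball finite_subset by blast
qed

end

section \<open>Cayley metrics as instances of the abstract setting\<close>

lemma cayley_geodesic_group:
  fixes G :: "('a, 'b) monoid_scheme" (structure)
  assumes "group G" and fin: "finite S" and S: "symmetric_generating_set G S"
  shows "geodesic_group G (cayley_dist G S)"
proof -
  interpret group G by fact
  let ?E = "cayley_edges G S"
  have Sc: "s \<in> S \<Longrightarrow> s \<in> carrier G" and Si: "s \<in> S \<Longrightarrow> inv s \<in> S"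
    and gen: "generate G S = carrier G" for s
    using S by (auto simp: symmetric_generating_set_def)
  have Ec: "x \<in> carrier G" "y \<in> carrier G" if "(x, y) \<in> ?E" for x y
    using that Sc by (auto simp: cayley_edges_def)
  have Esym: "(y, x) \<in> ?E" if xy: "(x, y) \<in> ?E" for x y
  proof -
    obtain s where s: "x \<in> carrier G" "s \<in> S" "y = x \<otimes> s" using xy unfolding cayley_edges_def by blast
    then have "x = y \<otimes> inv s" "y \<in> carrier G" using Sc by (auto simp: m_assoc)
    then show ?thesis using Si s(2) unfolding cayley_edges_def by blast
  qed
  have Eleft: "(g \<otimes> x, g \<otimes> y) \<in> ?E" if "g \<in> carrier G" "(x, y) \<in> ?E" for g x y
    using that Sc unfolding cayley_edges_def by (force simp: m_assoc)
  have Pleft: "(g \<otimes> x, g \<otimes> y) \<in> ?E ^^ n" if g: "g \<in> carrier G" and "(x, y) \<in> ?E ^^ n" for g x y n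
    using that(2) by (induction n arbitrary: y) (auto intro: Eleft[OF g] relcompI)
  have Psym: "(y, x) \<in> ?E ^^ n" if "(x, y) \<in> ?E ^^ n" for x y n
    using that
  proof (induction n arbitrary: y)
    case (Suc n)
    then obtain z where "(x, z) \<in> ?E ^^ n" "(z, y) \<in> ?E" by auto
    then show ?case using Suc.IH Esym by (meson relpow_Suc_I2)
  qed simp
  have reach1: "\<exists>n. (\<one>, y) \<in> ?E ^^ n" if "y \<in> generate G S" for y
    using that
  proof induction
    case one
    show ?case by (intro exI[of _ 0]) simp
  next
    case (incl h)
    then have "(\<one>, h) \<in> ?E" using Sc unfolding cayley_edges_def by force
    then show ?case by (intro exI[of _ 1]) simp
  next
    case (inv h)
    then have "(\<one>, inv h) \<in> ?E" using Sc Si unfolding cayley_edges_def by force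
    then show ?case by (intro exI[of _ 1]) simp
  next
    case (eng h1 h2)
    then obtain m n where mn: "(\<one>, h1) \<in> ?E ^^ m" "(\<one>, h2) \<in> ?E ^^ n" by blast
    have "h1 \<in> carrier G" using eng gen by auto
    \<comment> \<open>The walk to \<open>h2\<close>, translated by \<open>h1\<close>, continues the
      walk to \<open>h1\<close>.\<close>
    then have "(h1, h1 \<otimes> h2) \<in> ?E ^^ n" using Pleft[OF _ mn(2), of h1] by simp
    then have "(\<one>, h1 \<otimes> h2) \<in> ?E ^^ (m + n)" using mn(1) by (auto simp: relpow_add)
    then show ?case by blast
  qed
  have reach: "\<exists>n. (x, y) \<in> ?E ^^ n" if "x \<in> carrier G" "y \<in> carrier G" for x y
  proof -
    obtain n where "(\<one>, inv x \<otimes> y) \<in> ?E ^^ n" using reach1[of "inv x \<otimes> y"] gen \<open>x \<in> carrier G\<close> \<open>y \<in> carrier G\<close> by auto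
    from Pleft[OF \<open>x \<in> carrier G\<close> this] show ?thesis
      using that by (auto simp: m_assoc[symmetric])
  qed
  \<comment> \<open>Connectedness, coming from generation by \<open>S\<close>, ensures that the
    \<open>LEAST\<close> in the distance is the length of an actual walk.\<close>
  have attained: "\<exists>n. (x, y) \<in> ?E ^^ n \<and> cayley_dist G S x y = real n" if "x \<in> carrier G" "y \<in> carrier G" for x y
    using LeastI_ex[OF reach[OF that]] by (auto simp: cayley_dist_def)
  have le: "cayley_dist G S x y \<le> real n" if "(x, y) \<in> ?E ^^ n" for x y n
    using Least_le[of "\<lambda>n. (x, y) \<in> ?E ^^ n", OF that] by (simp add: cayley_dist_def)
  \<comment> \<open>Each walk extends in at most \<open>card S\<close> ways, so walks of fixed
    length have finitely many endpoints. Balls are covered by finitely many such sets.\<close>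
  have sphere: "finite {y. (x, y) \<in> ?E ^^ n}" for x n
  proof (induction n)
    case (Suc n)
    have "{y. (x, y) \<in> ?E ^^ Suc n} \<subseteq> (\<lambda>(z, s). z \<otimes> s) ` ({y. (x, y) \<in> ?E ^^ n} \<times> S)"
      by (force simp: cayley_edges_def)
    then show ?case by (rule finite_subset) (intro finite_imageI finite_cartesian_product Suc fin)
  qed simp
  show ?thesis
  proof unfold_locales
    fix x assume "x \<in> carrier G"
    show "cayley_dist G S x x = 0" using le[of x x 0] by (simp add: cayley_dist_def)
  next
    fix x y
    show "cayley_dist G S x y = cayley_dist G S y x"
      unfolding cayley_dist_def using Psym by metis
  next
    fix x y z assume xyz: "x \<in> carrier G" "y \<in> carrier G" "z \<in> carrier G"
    obtain m n where "(x, y) \<in> ?E ^^ m" "cayley_dist G S x y = real m"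
      "(y, z) \<in> ?E ^^ n" "cayley_dist G S y z = real n" using attained xyz by meson
    then show "cayley_dist G S x z \<le> cayley_dist G S x y + cayley_dist G S y z"
      using le[of x z "m + n"] by (auto simp: relpow_add)
  next
    fix g x y assume "g \<in> carrier G" "x \<in> carrier G" "y \<in> carrier G"
    then have "(g \<otimes> x, g \<otimes> y) \<in> ?E ^^ n \<longleftrightarrow> (x, y) \<in> ?E ^^ n" for n
      using Pleft[of g x y n] Pleft[of "inv g" "g \<otimes> x" "g \<otimes> y" n] by (auto simp: m_assoc[symmetric])
    then show "cayley_dist G S (g \<otimes> x) (g \<otimes> y) = cayley_dist G S x y"
      by (simp add: cayley_dist_def)
  next
    fix r :: real
    have "{x \<in> carrier G. cayley_dist G S \<one> x \<le> r} \<subseteq> (\<Union>n\<in>{n. real n \<le> r}. {y. (\<one>, y) \<in> ?E ^^ n})"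
      using attained[OF one_closed] by force
    moreover have "finite {n. real n \<le> r}"
      by (rule finite_subset[of _ "{..nat \<lfloor>r\<rfloor>}"]) (auto simp: le_nat_floor)
    ultimately show "finite {x \<in> carrier G. cayley_dist G S \<one> x \<le> r}"
      using sphere by (auto intro: finite_subset)
  next
    fix x y assume xy: "x \<in> carrier G" "y \<in> carrier G"
    obtain n where n: "(x, y) \<in> ?E ^^ n" "cayley_dist G S x y = real n" using attained[OF xy] by blast
    obtain f where f: "f 0 = x" "f n = y" "\<And>i. i < n \<Longrightarrow> (f i, f (Suc i)) \<in> ?E"
      using n(1) unfolding relpow_fun_conv by blast
    \<comment> \<open>The walk \<open>f\<close> is controlled only up to \<open>n\<close>; the
      default \<open>\<one>\<close> keeps the whole range of \<open>p\<close> in the group.\<close>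
    define p where "p i = (if i \<le> n then f i else \<one>)" for i
    have "f i \<in> carrier G" if "i \<le> n" for i
      using that f xy Ec by (cases "i = n") (auto simp: le_less)
    then have "range p \<subseteq> carrier G" by (auto simp: p_def)
    moreover have "cayley_dist G S (p i) (p (Suc i)) \<le> 1" if "i < n" for i
      using le[of "f i" "f (Suc i)" 1] f(3)[OF that] that by (simp add: p_def)
    ultimately show "\<exists>n p. range p \<subseteq> carrier G \<and> p 0 = x \<and> p n = y \<and> cayley_dist G S x y = real n \<and>
        (\<forall>i<n. cayley_dist G S (p i) (p (Suc i)) \<le> 1)"
      using f(1,2) n(2) by (intro exI[of _ n] exI[of _ p]) (auto simp: p_def)
  qed
qed

theorem lemma1p5:
  fixes G :: "('a, 'b) monoid_scheme" and d :: "'a \<Rightarrow> 'a \<Rightarrow> real"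
  assumes "group G"
    and "cayley_metric G d"
    and "finite (busemann_points G d)"
  shows "finite (annihilator G (metric_boundary G d))"
proof -
  obtain S where "finite S" "symmetric_generating_set G S" "d = cayley_dist G S"
    using assms(2) unfolding cayley_metric_def by blast
  then have "geodesic_group G d" using cayley_geodesic_group[OF assms(1)] by simp
  then have "finite_busemann G d"
    using assms(3) by (simp add: finite_busemann_def finite_busemann_axioms_def)
  then show ?thesis by (rule finite_busemann.finite_annihilator_boundary)
qed

end
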